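(* Let $n\ge2$. With multiplication carried out in $H(\infty)$, for every $1\le k\le n-1$, $$P\big|_{\theta=0}=R\big|_{\theta=0}=K\big|_{\theta=0}=\widetilde T_{(1\,n)} .$$ That is, at $\theta=0$ both the $q$-deformed $k$-star transposition shuffle, for every $k$, and the $q$-random-to-random shuffle become the short systematic scan.
   Context: $s_i=(i\ i+1)\in S_n$, $\ell$ is the number of inversions, $\theta=q^{-1}$, $[r]_q=\frac{q^r-1}{q-1}$. $H(\infty)$ (the $q\to\infty$, i.e. $\theta\to0$, degeneration of the type $A$ Iwahori--Hecke algebra in its normalized basis) is the algebra with basis $\{\widetilde T_w\}_{w\in S_n}$ in which $\widetilde T_{s_i}\widetilde T_w=\widetilde T_{s_iw}$ if $\ell(s_iw)>\ell(w)$ and $\widetilde T_{s_i}\widetilde T_w=\widetilde T_w$ if $\ell(s_iw)<\ell(w)$. For $q>1$ the shuffles are given by the expressions: $$P=\frac{1}{[n]_q}\widetilde T_e+\frac{q[n-1]_q}{[n]_q\sum_{l=1}^k[n-l]_q}\sum_{l=1}^{k}\sum_{i=1}^{n-l}q^{n-l-i}\,\widetilde T_{(i,\,n+1-l)},$$ $$R=\Bigl(\frac1{[n]_q}\sum_{i=1}^nq^{n-i}\widetilde T_{s_is_{i+1}\cdots s_{n-1}}\Bigr)\Bigl(\frac1{[n]_q}\sum_{j=1}^nq^{n-j}\widetilde T_{s_{n-1}s_{n-2}\cdots s_j}\Bigr),$$ (the terms $i=n$ and $j=n$ being $\widetilde T_e$), and $$K=\widetilde T_{s_{n-1}}\cdots\widetilde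 T_{s_2}\widetilde T_{s_1}^2\widetilde T_{s_2}\cdots\widetilde T_{s_{n-1}}.$$ $(\cdot)|_{\theta=0}$ denotes the element of $H(\infty)$ obtained from such an expression by replacing every scalar coefficient by its limit as $q\to\infty$ and performing all products in $H(\infty)$. *)

theory Defs
  imports Complex_Main "HOL-Combinatorics.Permutations"
begin

section \<open>Permutations, simple transpositions and inversions\<close>

text \<open>The symmetric group $S_n$ is the set of all \<open>w\<close> with \<open>w permutes {1..n}\<close>; its product is
  composition of functions.\<close>

definition sref :: "nat \<Rightarrow> nat \<Rightarrow> nat" where
  "sref i = transpose i (i + 1)"

definition sprod :: "nat list \<Rightarrow> nat \<Rightarrow> nat" where
  "sprod is = foldr (\<lambda>i u. sref i \<circ> u) is id"

definition inversions :: "nat \<Rightarrow> (nat \<Rightarrow> nat) \<Rightarrow> (nat \<times> nat) set" where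
  "inversions n w = {(a, b). a \<in> {1..n} \<and> b \<in> {1..n} \<and> a < b \<and> w a > w b}"

definition len :: "nat \<Rightarrow> (nat \<Rightarrow> nat) \<Rightarrow> nat" where
  "len n w = card (inversions n w)"


section \<open>The algebra $H(\infty)$\<close>

text \<open>An element $\sum_{w \in S_n} c_w \widetilde T_w$ is represented by its coefficient function
  $w \mapsto c_w$, which vanishes outside $S_n$.\<close>

type_synonym hecke = "(nat \<Rightarrow> nat) \<Rightarrow> real"

definition hecke_carrier :: "nat \<Rightarrow> hecke set" where
  "hecke_carrier n = {f. \<forall>w. \<not> w permutes {1..n} \<longrightarrow> f w = 0}"

definition T :: "(nat \<Rightarrow> nat) \<Rightarrow> hecke" where
  "T w = (\<lambda>v. if v = w then 1 else 0)"

text \<open>Left multiplication of a basis element by $\widetilde T_{s_i}$.\<close>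

definition lact :: "nat \<Rightarrow> nat \<Rightarrow> (nat \<Rightarrow> nat) \<Rightarrow> (nat \<Rightarrow> nat)" where
  "lact n i w = (if len n (sref i \<circ> w) > len n w then sref i \<circ> w else w)"

definition reduced_word :: "nat \<Rightarrow> (nat \<Rightarrow> nat) \<Rightarrow> nat list \<Rightarrow> bool" where
  "reduced_word n u is \<longleftrightarrow> set is \<subseteq> {1..<n} \<and> u = sprod is \<and> length is = len n u"

text \<open>If $u = s_{i_1} \cdots s_{i_r}$ is reduced, then the multiplication rule gives
  $\widetilde T_u = \widetilde T_{s_{i_1}} \cdots \widetilde T_{s_{i_r}}$, so the rule determines
  $\widetilde T_u \widetilde T_v$, which is again a basis element \<open>T (dem n u v)\<close>. The choice of the
  reduced word is immaterial (\<open>dem_eq\<close> below).\<close>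

definition dem :: "nat \<Rightarrow> (nat \<Rightarrow> nat) \<Rightarrow> (nat \<Rightarrow> nat) \<Rightarrow> (nat \<Rightarrow> nat)" where
  "dem n u v = foldr (lact n) (SOME is. reduced_word n u is) v"

definition hmult :: "nat \<Rightarrow> hecke \<Rightarrow> hecke \<Rightarrow> hecke" where
  "hmult n f g = (\<lambda>w. \<Sum>u | u permutes {1..n}. \<Sum>v | v permutes {1..n}.
      f u * g v * T (dem n u v) w)"


section \<open>The shuffles and their value at $\theta = 0$\<close>

definition qnum :: "real \<Rightarrow> nat \<Rightarrow> real" where
  "qnum q r = (q ^ r - 1) / (q - 1)"

text \<open>An expression is a list of factors to be multiplied; a factor is a linear combination of the
  $\widetilde T_w$ whose coefficients depend on $q$. The products are only performed after the
  limit $q \to \infty$ has been taken in every coefficient, since for finite $q$ they would belong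
  to a different algebra.\<close>

type_synonym qexpr = "(real \<Rightarrow> hecke) list"

definition coeff_limit :: "(real \<Rightarrow> hecke) \<Rightarrow> hecke" where
  "coeff_limit F = (\<lambda>w. Lim at_top (\<lambda>q. F q w))"

definition at_theta0 :: "nat \<Rightarrow> qexpr \<Rightarrow> hecke" where
  "at_theta0 n Fs = foldr (hmult n) (map coeff_limit Fs) (T id)"

definition star_shuffle :: "nat \<Rightarrow> nat \<Rightarrow> qexpr" where
  "star_shuffle n k =
    [\<lambda>q w. 1 / qnum q n * T id w
       + q * qnum q (n - 1) / (qnum q n * (\<Sum>l=1..k. qnum q (n - l)))
         * (\<Sum>l=1..k. \<Sum>i=1..n-l. q ^ (n - l - i) * T (transpose i (n + 1 - l)) w)]"

definition random_to_random :: "nat \<Rightarrow> qexpr" where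
  "random_to_random n =
    [\<lambda>q w. 1 / qnum q n * (\<Sum>i=1..n. q ^ (n - i) * T (sprod [i..<n]) w),
     \<lambda>q w. 1 / qnum q n * (\<Sum>j=1..n. q ^ (n - j) * T (sprod (rev [j..<n])) w)]"

definition systematic_scan :: "nat \<Rightarrow> qexpr" where
  "systematic_scan n = map (\<lambda>i q. T (sref i)) (rev [1..<n] @ [1..<n])"


section \<open>The product is the one of $H(\infty)$\<close>

lemma sref_sref [simp]: "sref i (sref i x) = x"
  by (simp add: sref_def)

lemma sref_comp_sref: "sref i \<circ> (sref i \<circ> w) = w" "(w \<circ> sref i) \<circ> sref i = w"
  by (auto simp: fun_eq_iff)

lemma sref_permutes: "i \<in> {1..<n} \<Longrightarrow> sref i permutes {1..n}"
  unfolding sref_def by (rule permutes_swap_id) auto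

lemma sref_less_iff:
  "a \<noteq> b \<Longrightarrow> {a, b} \<noteq> {i, i + 1} \<Longrightarrow> sref i a < sref i b \<longleftrightarrow> a < b"
  by (auto simp: sref_def transpose_def doubleton_eq_iff)

lemma inv_sref: "inv (sref i) = sref i"
  by (simp add: sref_def)

lemma finite_inversions [simp]: "finite (inversions n w)"
  by (rule finite_subset[of _ "{1..n} \<times> {1..n}"]) (auto simp: inversions_def)

lemma len_id [simp]: "len n id = 0"
proof -
  have "inversions n id = {}" by (auto simp: inversions_def)
  then show ?thesis by (simp add: len_def)
qed

context
  fixes n i :: nat and w :: "nat \<Rightarrow> nat"
  assumes i: "i \<in> {1..<n}" and w: "w permutes {1..n}"
begin

lemma len_sref_up:
  assumes "inv w i < inv w (i + 1)"
  shows "len n (sref i \<circ> w) = Suc (len n w)"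
proof -
  define p r where "p = inv w i" and "r = inv w (i + 1)"
  have wp: "w p = i" "w r = i + 1"
    unfolding p_def r_def using permutes_inverses[OF w] by auto
  have mem: "p \<in> {1..n}" "r \<in> {1..n}"
    using wp i permutes_in_image[OF w, of p] permutes_in_image[OF w, of r] by auto
  have inj: "w a = w b \<longleftrightarrow> a = b" for a b
    using permutes_inj[OF w] by (auto dest: injD)
  have *: "w a > w b \<longleftrightarrow> sref i (w a) > sref i (w b)"
    if "a < b" "(a, b) \<noteq> (p, r)" for a b
  proof -
    have "{w b, w a} \<noteq> {i, i + 1}"
      using that assms wp inj unfolding p_def[symmetric] r_def[symmetric] doubleton_eq_iff
      by (metis less_asym)
    then show ?thesis
      using sref_less_iff[of "w b" "w a" i] that inj by auto
  qed
  have "sref i (w p) > sref i (w r)"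
    by (simp add: wp sref_def)
  moreover have "p < r" using assms by (simp add: p_def r_def)
  ultimately have "inversions n (sref i \<circ> w) = insert (p, r) (inversions n w)"
    using mem * by (auto simp: inversions_def)
  moreover have "(p, r) \<notin> inversions n w"
    by (simp add: inversions_def wp)
  ultimately show ?thesis
    by (simp add: len_def)
qed

end

lemma len_sref_down:
  assumes i: "i \<in> {1..<n}" and w: "w permutes {1..n}" and d: "inv w (i + 1) < inv w i"
  shows "len n w = Suc (len n (sref i \<circ> w))"
proof -
  have sw: "sref i \<circ> w permutes {1..n}"
    using permutes_compose[OF w sref_permutes[OF i]] .
  have "inv (sref i \<circ> w) = inv w \<circ> sref i"
    using permutes_inv_o[OF w] permutes_bij[OF w] permutes_bij[OF sref_permutes[OF i]]
    by (simp add: o_inv_distrib inv_sref)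
  then have "inv (sref i \<circ> w) i < inv (sref i \<circ> w) (i + 1)"
    using d by (simp add: sref_def)
  from len_sref_up[OF i sw this] show ?thesis
    by (simp add: sref_comp_sref)
qed

lemma inv_Suc_neq:
  fixes i :: nat
  assumes "w permutes {1..n}"
  shows "inv w i \<noteq> inv w (i + 1)"
proof
  assume "inv w i = inv w (i + 1)"
  then have "w (inv w i) = w (inv w (i + 1))" by simp
  then show False by (simp add: permutes_inverses(1)[OF assms])
qed

lemma lact_altdef:
  assumes i: "i \<in> {1..<n}" and w: "w permutes {1..n}"
  shows "lact n i w = (if inv w i < inv w (i + 1) then sref i \<circ> w else w)"
proof -
  have "inv w i \<noteq> inv w (i + 1)"
    by (rule inv_Suc_neq[OF w])
  then consider "inv w i < inv w (i + 1)" | "inv w (i + 1) < inv w i" by linarith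
  then show ?thesis
  proof cases
    case 1
    then show ?thesis using len_sref_up[OF i w 1] by (simp add: lact_def)
  next
    case 2
    then show ?thesis using len_sref_down[OF i w 2] by (simp add: lact_def)
  qed
qed

lemma lact_permutes:
  assumes "i \<in> {1..<n}" "w permutes {1..n}"
  shows "lact n i w permutes {1..n}"
  using permutes_compose[OF assms(2) sref_permutes[OF assms(1)]] assms by (simp add: lact_def)

definition ract :: "nat \<Rightarrow> (nat \<Rightarrow> nat) \<Rightarrow> (nat \<Rightarrow> nat)" where
  "ract j w = (if w j < w (j + 1) then w \<circ> sref j else w)"

lemma ract_permutes:
  assumes "j \<in> {1..<n}" "w permutes {1..n}"
  shows "ract j w permutes {1..n}"
  using permutes_compose[OF sref_permutes[OF assms(1)] assms(2)] assms by (simp add: ract_def)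

lemma inv_lact:
  assumes i: "i \<in> {1..<n}" and w: "w permutes {1..n}"
  shows "inv (lact n i w) = ract i (inv w)"
  using permutes_bij[OF w] permutes_bij[OF sref_permutes[OF i]]
  by (simp add: lact_altdef[OF i w] ract_def o_inv_distrib inv_sref)

lemma lact_ract:
  assumes i: "i \<in> {1..<n}" and j: "j \<in> {1..<n}" and w: "w permutes {1..n}"
  shows "lact n i (ract j w) = ract j (lact n i w)"
proof -
  define p r where "p = inv w i" and "r = inv w (Suc i)"
  have wp: "w p = i" "w r = i + 1"
    unfolding p_def r_def using permutes_inverses[OF w] by auto
  have inj: "w a = w b \<longleftrightarrow> a = b" for a b
    using permutes_inj[OF w] by (auto dest: injD)
  have prne: "p \<noteq> r" using wp by auto
  have winv: "inv w (w a) = a" "w (inv w a) = a" for a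
    using permutes_inverses[OF w] by auto
  have ws: "w \<circ> sref j permutes {1..n}"
    using permutes_compose[OF sref_permutes[OF j] w] .
  have inv_ws: "inv (w \<circ> sref j) = sref j \<circ> inv w"
    using permutes_bij[OF w] permutes_bij[OF sref_permutes[OF j]]
    by (simp add: o_inv_distrib inv_sref)
  consider "p = j" "r = j + 1" | "p = j + 1" "r = j" | "{p, r} \<noteq> {j, j + 1}"
    by (auto simp: doubleton_eq_iff)
  then show ?thesis
  proof cases
    case 1
    have eq: "sref i \<circ> w = w \<circ> sref j"
    proof
      fix x
      show "(sref i \<circ> w) x = (w \<circ> sref j) x"
        using 1 wp inj[of x j] inj[of x "j + 1"]
        by (auto simp: sref_def transpose_def)
    qed
    have R: "ract j w = w \<circ> sref j" using 1 wp by (simp add: ract_def)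
    have L: "lact n i w = sref i \<circ> w"
      using 1 p_def r_def by (simp add: lact_altdef[OF i w])
    have "lact n i (w \<circ> sref j) = w \<circ> sref j"
    proof -
      have "inv w i = j" "inv w (Suc i) = Suc j"
        using 1 by (simp_all add: p_def r_def)
      then show ?thesis
        using lact_altdef[OF i ws] inv_ws by (simp add: sref_def)
    qed
    moreover have "ract j (sref i \<circ> w) = sref i \<circ> w"
      using 1 wp by (simp add: ract_def sref_def)
    ultimately show ?thesis by (simp add: R L eq)
  next
    case 2
    have "ract j w = w" using 2 wp by (simp add: ract_def)
    moreover have "lact n i w = w"
      using 2 p_def r_def by (simp add: lact_altdef[OF i w])
    ultimately show ?thesis by simp
  next
    case 3
    have "sref j p < sref j r \<longleftrightarrow> p < r"
      using sref_less_iff[OF prne 3] .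
    moreover have "{w j, w (j + 1)} \<noteq> {i, i + 1}"
      using 3 wp inj by (metis doubleton_eq_iff)
    then have "sref i (w j) < sref i (w (j + 1)) \<longleftrightarrow> w j < w (j + 1)"
      by (intro sref_less_iff) (auto simp: inj)
    ultimately show ?thesis
      using lact_altdef[OF i w] lact_altdef[OF i ws] inv_ws
      by (auto simp: ract_def o_assoc simp flip: p_def r_def)
  qed
qed

lemma sprod_Cons: "sprod (i # is) = sref i \<circ> sprod is"
  by (simp add: sprod_def)

lemma sprod_Nil: "sprod [] = id"
  by (simp add: sprod_def)

lemma sprod_permutes: "set is \<subseteq> {1..<n} \<Longrightarrow> sprod is permutes {1..n}"
proof (induction "is")
  case Nil
  show ?case by (simp only: sprod_Nil permutes_id)
next
  case (Cons i "is")
  then have "sprod is permutes {1..n}" "sref i permutes {1..n}"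
    using sref_permutes[of i n] by auto
  then show ?case
    unfolding sprod_Cons by (rule permutes_compose)
qed

lemma len_sref_le:
  assumes "i \<in> {1..<n}" "w permutes {1..n}"
  shows "len n (sref i \<circ> w) \<le> Suc (len n w)"
proof -
  have "inv w i \<noteq> inv w (i + 1)"
    by (rule inv_Suc_neq[OF assms(2)])
  then consider "inv w i < inv w (i + 1)" | "inv w (i + 1) < inv w i" by linarith
  then show ?thesis
  proof cases
    case 1
    show ?thesis using len_sref_up[OF assms 1] by simp
  next
    case 2
    show ?thesis using len_sref_down[OF assms 2] by simp
  qed
qed

lemma len_sprod_le: "set is \<subseteq> {1..<n} \<Longrightarrow> len n (sprod is) \<le> length is"
proof (induction "is")
  case (Cons i "is")
  then have "len n (sref i \<circ> sprod is) \<le> Suc (length is)"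
    using len_sref_le[of i n "sprod is"] sprod_permutes[of "is" n] by simp
  then show ?case
    by (simp only: sprod_Cons list.size add_0_right add_Suc_right)
qed (simp add: sprod_Nil)

lemma reduced_foldr:
  "set is \<subseteq> {1..<n} \<Longrightarrow> length is = len n (sprod is) \<Longrightarrow> foldr (lact n) is id = sprod is"
proof (induction "is")
  case (Cons i "is")
  have "len n (sprod is) \<le> length is" using Cons.prems by (intro len_sprod_le) simp
  moreover have "len n (sref i \<circ> sprod is) \<le> Suc (len n (sprod is))"
    using Cons.prems by (intro len_sref_le sprod_permutes) auto
  ultimately have *: "length is = len n (sprod is)" "len n (sref i \<circ> sprod is) > len n (sprod is)"
    using Cons.prems(2)[unfolded sprod_Cons list.size] by linarith+
  have "foldr (lact n) is id = sprod is"
    using Cons.prems(1) *(1) by (intro Cons.IH) simp_all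
  moreover have "lact n i (sprod is) = sref i \<circ> sprod is"
    using *(2) by (simp only: lact_def if_True)
  ultimately show ?case
    by (simp only: sprod_Cons foldr.simps o_apply)
qed (simp add: sprod_Nil)

lemma no_descent_id:
  fixes n :: nat
  assumes w: "w permutes {1..n}" and "\<And>i. i \<in> {1..<n} \<Longrightarrow> w i < w (i + 1)"
  shows "w = id"
proof -
  have mono: "w a + (b - a) \<le> w b" if "a \<ge> 1" "a \<le> b" "b \<le> n" for a b
    using that(2,3)
  proof (induction b rule: dec_induct)
    case (step m)
    then show ?case using assms(2)[of m] that(1) by simp
  qed simp
  show ?thesis
  proof
    fix x
    show "w x = id x"
    proof (cases "x \<in> {1..n}")
      case True
      then have "w 1 \<in> {1..n}" "w n \<in> {1..n}"
        using permutes_in_image[OF w, of 1] permutes_in_image[OF w, of n] by auto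
      then show ?thesis using mono[of 1 x] mono[of x n] True by auto
    next
      case False
      then show ?thesis using permutes_not_in[OF w] by simp
    qed
  qed
qed

lemma reduced_word_exists: "w permutes {1..n} \<Longrightarrow> \<exists>is. reduced_word n w is"
proof (induction "len n w" arbitrary: w rule: less_induct)
  case less
  show ?case
  proof (cases "\<exists>i\<in>{1..<n}. inv w (i + 1) < inv w i")
    case True
    then obtain i where i: "i \<in> {1..<n}" "inv w (i + 1) < inv w i" by blast
    have l: "len n w = Suc (len n (sref i \<circ> w))"
      using len_sref_down[OF i(1) less.prems i(2)] .
    moreover have "sref i \<circ> w permutes {1..n}"
      using permutes_compose[OF less.prems sref_permutes[OF i(1)]] .
    ultimately obtain "is" where "reduced_word n (sref i \<circ> w) is"
      using less.hyps[of "sref i \<circ> w"] by auto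
    then have "reduced_word n w (i # is)"
      using i(1) l sref_comp_sref(1)[of i w] unfolding reduced_word_def sprod_Cons by auto
    then show ?thesis by blast
  next
    case False
    have "inv w = id"
    proof (rule no_descent_id[OF permutes_inv[OF less.prems]])
      fix i assume "i \<in> {1..<n}"
      moreover have "inv w i \<noteq> inv w (i + 1)"
        by (rule inv_Suc_neq[OF less.prems])
      ultimately show "inv w i < inv w (i + 1)" using False by force
    qed
    then have "w = id"
      using permutes_inv_inv[OF less.prems] by simp
    then have "reduced_word n w []" by (simp add: reduced_word_def sprod_Nil)
    then show ?thesis by blast
  qed
qed

lemma foldr_lact_permutes:
  "set is \<subseteq> {1..<n} \<Longrightarrow> w permutes {1..n} \<Longrightarrow> foldr (lact n) is w permutes {1..n}"
  by (induction "is") (auto intro!: lact_permutes simp del: One_nat_def)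

lemma foldr_ract_permutes:
  "set is \<subseteq> {1..<n} \<Longrightarrow> w permutes {1..n} \<Longrightarrow> foldr ract is w permutes {1..n}"
  by (induction "is") (auto intro!: ract_permutes simp del: One_nat_def)

lemma inv_foldr_lact:
  "set is \<subseteq> {1..<n} \<Longrightarrow> w permutes {1..n} \<Longrightarrow>
    inv (foldr (lact n) is w) = foldr ract is (inv w)"
  by (induction "is") (simp_all add: inv_lact foldr_lact_permutes del: One_nat_def)

lemma lact_foldr_ract:
  "set js \<subseteq> {1..<n} \<Longrightarrow> i \<in> {1..<n} \<Longrightarrow> w permutes {1..n} \<Longrightarrow>
    lact n i (foldr ract js w) = foldr ract js (lact n i w)"
  by (induction js) (simp_all add: lact_ract foldr_ract_permutes del: One_nat_def)

lemma foldr_lact_ract: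
  "set is \<subseteq> {1..<n} \<Longrightarrow> set js \<subseteq> {1..<n} \<Longrightarrow> w permutes {1..n} \<Longrightarrow>
    foldr (lact n) is (foldr ract js w) = foldr ract js (foldr (lact n) is w)"
  by (induction "is") (simp_all add: lact_foldr_ract foldr_lact_permutes del: One_nat_def)

lemma right_word_exists:
  assumes "w permutes {1..n}"
  obtains js where "set js \<subseteq> {1..<n}" "w = foldr ract js id"
proof -
  obtain js where js: "reduced_word n (inv w) js"
    using reduced_word_exists[OF permutes_inv[OF assms]] by blast
  then have "set js \<subseteq> {1..<n}" "inv w = foldr (lact n) js id"
    using reduced_foldr[of js n] by (auto simp: reduced_word_def)
  then show thesis
    using that[of js] inv_foldr_lact[of js n id] permutes_inv_inv[OF assms]
    by (simp add: permutes_id)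
qed

lemma foldr_lact_reduced:
  assumes "reduced_word n u is" "set js \<subseteq> {1..<n}"
  shows "foldr (lact n) is (foldr ract js id) = foldr ract js u"
  using assms foldr_lact_ract[of "is" n js id] reduced_foldr[of "is" n]
  by (auto simp: reduced_word_def permutes_id)

lemma dem_foldr_ract:
  assumes "u permutes {1..n}" "set js \<subseteq> {1..<n}"
  shows "dem n u (foldr ract js id) = foldr ract js u"
  unfolding dem_def
  using foldr_lact_reduced[OF someI_ex[OF reduced_word_exists[OF assms(1)]] assms(2)] .

lemma dem_eq:
  assumes "reduced_word n u is" "v permutes {1..n}"
  shows "dem n u v = foldr (lact n) is v"
proof -
  obtain js where js: "set js \<subseteq> {1..<n}" "v = foldr ract js id"
    using right_word_exists[OF assms(2)] by blast
  have "u permutes {1..n}"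
    using assms(1) sprod_permutes by (auto simp: reduced_word_def)
  then show ?thesis
    using foldr_lact_reduced[OF assms(1) js(1)] dem_foldr_ract[OF _ js(1)] js(2) by simp
qed

lemma dem_permutes:
  assumes "u permutes {1..n}" "v permutes {1..n}"
  shows "dem n u v permutes {1..n}"
proof -
  obtain js where "set js \<subseteq> {1..<n}" "v = foldr ract js id"
    using right_word_exists[OF assms(2)] by blast
  then show ?thesis using dem_foldr_ract foldr_ract_permutes assms(1) by metis
qed

lemma dem_id_right: "u permutes {1..n} \<Longrightarrow> dem n u id = u"
  using dem_foldr_ract[of u n "[]"] by simp

lemma dem_id_left: "v permutes {1..n} \<Longrightarrow> dem n id v = v"
  using right_word_exists[of v n] dem_foldr_ract[of id n] permutes_id by metis

lemma dem_assoc: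
  assumes "u permutes {1..n}" "v permutes {1..n}" "w permutes {1..n}"
  shows "dem n (dem n u v) w = dem n u (dem n v w)"
proof -
  obtain js where js: "set js \<subseteq> {1..<n}" "w = foldr ract js id"
    using right_word_exists[OF assms(3)] by blast
  obtain ks where ks: "set ks \<subseteq> {1..<n}" "v = foldr ract ks id"
    using right_word_exists[OF assms(2)] by blast
  have "dem n u (dem n v w) = dem n u (foldr ract (js @ ks) id)"
    using dem_foldr_ract[OF assms(2) js(1)] js ks by simp
  also have "\<dots> = foldr ract js (foldr ract ks u)"
    using dem_foldr_ract[OF assms(1), of "js @ ks"] js ks by simp
  also have "\<dots> = foldr ract js (dem n u v)"
    using dem_foldr_ract[OF assms(1) ks(1)] ks by simp
  also have "\<dots> = dem n (dem n u v) w"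
    using dem_foldr_ract[OF dem_permutes[OF assms(1,2)] js(1)] js by simp
  finally show ?thesis by simp
qed

lemma dem_sref:
  assumes i: "i \<in> {1..<n}" and w: "w permutes {1..n}"
  shows "dem n (sref i) w = lact n i w"
proof -
  have "len n (sref i) = 1"
    using len_sref_up[OF i permutes_id] by simp
  then have "reduced_word n (sref i) [i]"
    using i by (simp add: reduced_word_def sprod_Cons sprod_Nil)
  from dem_eq[OF this w] show ?thesis by simp
qed

lemma T_in_carrier: "w permutes {1..n} \<Longrightarrow> T w \<in> hecke_carrier n"
  by (auto simp: hecke_carrier_def T_def)

lemma hecke_expand:
  assumes "f \<in> hecke_carrier n"
  shows "f v = (\<Sum>w | w permutes {1..n}. f w * T w v)"
  using assms finite_permutations[of "{1..n}"]
  by (auto simp: hecke_carrier_def T_def if_distrib[of "\<lambda>x. _ * x"] sum.delta cong: if_cong)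

lemma sum_T:
  assumes "u permutes {1..n}"
  shows "(\<Sum>v | v permutes {1..n}. T u v * F v) = F u"
proof -
  have "(\<Sum>v | v permutes {1..n}. T u v * F v) = (\<Sum>v | v permutes {1..n}. if v = u then F v else 0)"
    by (rule sum.cong) (auto simp: T_def)
  then show ?thesis
    using assms finite_permutations[of "{1..n}"] by simp
qed

lemma hmult_T_T:
  assumes "u permutes {1..n}" "v permutes {1..n}"
  shows "hmult n (T u) (T v) = T (dem n u v)"
  unfolding hmult_def mult.assoc sum_distrib_left[symmetric] sum_T[OF assms(1)] sum_T[OF assms(2)] ..

text \<open>The defining multiplication rule of $H(\infty)$.\<close>

theorem hmult_T_sref:
  assumes "i \<in> {1..<n}" "w permutes {1..n}"
  shows "len n (sref i \<circ> w) > len n w \<Longrightarrow> hmult n (T (sref i)) (T w) = T (sref i \<circ> w)"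
    and "len n (sref i \<circ> w) < len n w \<Longrightarrow> hmult n (T (sref i)) (T w) = T w"
  using hmult_T_T[OF sref_permutes[OF assms(1)] assms(2)] dem_sref[OF assms]
  by (simp_all add: lact_def)

lemma hmult_in_carrier: "hmult n f g \<in> hecke_carrier n"
  unfolding hecke_carrier_def hmult_def
  by (auto intro!: sum.neutral simp: T_def dem_permutes simp del: One_nat_def)

lemma hmult_add_left: "hmult n (\<lambda>w. f w + f' w) g = (\<lambda>w. hmult n f g w + hmult n f' g w)"
  by (simp add: hmult_def distrib_right sum.distrib)

lemma hmult_add_right: "hmult n f (\<lambda>w. g w + g' w) = (\<lambda>w. hmult n f g w + hmult n f g' w)"
  by (simp add: hmult_def distrib_left distrib_right sum.distrib)

lemma hmult_scale_left: "hmult n (\<lambda>w. c * f w) g = (\<lambda>w. c * hmult n f g w)"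
  by (simp add: hmult_def sum_distrib_left mult_ac)

lemma hmult_scale_right: "hmult n f (\<lambda>w. c * g w) = (\<lambda>w. c * hmult n f g w)"
  by (simp add: hmult_def sum_distrib_left mult_ac)

lemma hmult_id_left:
  assumes "f \<in> hecke_carrier n"
  shows "hmult n (T id) f = f"
proof
  fix w
  have "hmult n (T id) f w = (\<Sum>v | v permutes {1..n}. f v * T (dem n id v) w)"
    unfolding hmult_def mult.assoc sum_distrib_left[symmetric] sum_T[OF permutes_id] ..
  also have "\<dots> = (\<Sum>v | v permutes {1..n}. f v * T v w)"
    by (rule sum.cong) (auto simp: dem_id_left simp del: One_nat_def)
  also have "\<dots> = f w"
    by (rule hecke_expand[OF assms, symmetric])
  finally show "hmult n (T id) f w = f w" .
qed

lemma hmult_id_right: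
  assumes "f \<in> hecke_carrier n"
  shows "hmult n f (T id) = f"
proof
  fix w
  have "hmult n f (T id) w = (\<Sum>v | v permutes {1..n}. f v * T (dem n v id) w)"
    unfolding hmult_def mult.assoc sum_distrib_left[symmetric] sum_T[OF permutes_id] ..
  also have "\<dots> = (\<Sum>v | v permutes {1..n}. f v * T v w)"
    by (rule sum.cong) (auto simp: dem_id_right simp del: One_nat_def)
  also have "\<dots> = f w"
    by (rule hecke_expand[OF assms, symmetric])
  finally show "hmult n f (T id) w = f w" .
qed

lemma sum_hmult:
  "(\<Sum>x | x permutes {1..n}. hmult n f g x * F x) =
    (\<Sum>u | u permutes {1..n}. \<Sum>v | v permutes {1..n}. f u * g v * F (dem n u v))"
proof -
  have "(\<Sum>x | x permutes {1..n}. hmult n f g x * F x) =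
    (\<Sum>x | x permutes {1..n}. \<Sum>u | u permutes {1..n}. \<Sum>v | v permutes {1..n}.
        f u * g v * (T (dem n u v) x * F x))"
    by (simp add: hmult_def sum_distrib_right mult.assoc)
  also have "\<dots> = (\<Sum>u | u permutes {1..n}. \<Sum>x | x permutes {1..n}. \<Sum>v | v permutes {1..n}.
        f u * g v * (T (dem n u v) x * F x))"
    by (rule sum.swap)
  also have "\<dots> = (\<Sum>u | u permutes {1..n}. \<Sum>v | v permutes {1..n}. \<Sum>x | x permutes {1..n}.
        f u * g v * (T (dem n u v) x * F x))"
    by (rule sum.cong[OF refl]) (rule sum.swap)
  also have "\<dots> = (\<Sum>u | u permutes {1..n}. \<Sum>v | v permutes {1..n}. f u * g v * F (dem n u v))"
    by (intro sum.cong refl) (simp add: sum_T dem_permutes del: One_nat_def flip: sum_distrib_left)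
  finally show ?thesis .
qed

theorem hmult_assoc: "hmult n (hmult n f g) h = hmult n f (hmult n g h)"
proof
  fix w
  let ?S = "{u. u permutes {1..n}}"
  have "hmult n (hmult n f g) h w = (\<Sum>x\<in>?S. hmult n f g x * (\<Sum>y\<in>?S. h y * T (dem n x y) w))"
    by (simp add: hmult_def[of n "hmult n f g"] sum_distrib_left mult.assoc)
  also have "\<dots> = (\<Sum>u\<in>?S. \<Sum>v\<in>?S. f u * g v * (\<Sum>y\<in>?S. h y * T (dem n (dem n u v) y) w))"
    by (rule sum_hmult)
  also have "\<dots> = (\<Sum>u\<in>?S. f u * (\<Sum>v\<in>?S. \<Sum>y\<in>?S. g v * h y * T (dem n u (dem n v y)) w))"
    by (auto simp: sum_distrib_left mult.assoc dem_assoc simp del: One_nat_def intro!: sum.cong)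
  also have "\<dots> = (\<Sum>u\<in>?S. f u * (\<Sum>x\<in>?S. hmult n g h x * T (dem n u x) w))"
    by (simp only: sum_hmult)
  also have "\<dots> = hmult n f (hmult n g h) w"
    by (simp add: hmult_def[of n f "hmult n g h"] sum_distrib_left mult.assoc)
  finally show "hmult n (hmult n f g) h w = hmult n f (hmult n g h) w" .
qed

end

theory Submission
  imports Defs
begin

text \<open>
  As \<open>q \<longlonglongrightarrow> \<infinity>\<close>, the number $[r]_q$ grows like $q^{r-1}$, so each factor of the three
  expressions keeps only the basis elements that carry the highest power of \<open>q\<close>, and in each factor
  this is a single one. For the star transposition shuffle it is the pair $l = i = 1$, that is,
  $\widetilde T_{(1\,n)}$, whatever \<open>k\<close> is. For the random-to-random shuffle it is $i = 1$ and
  $j = 1$, which leaves the product of $\widetilde T_{s_1 \cdots s_{n-1}}$ and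
  $\widetilde T_{s_{n-1} \cdots s_1}$ (\<open>coeff_limit_geometric_weights\<close>).

  The two words in these subscripts have distinct letters and are therefore reduced
  (\<open>reduced_word_distinct\<close>). So the random-to-random shuffle and the systematic scan are both
  products of the generators along a palindrome: \<open>1, \<dots>, n - 1, n - 1, \<dots>, 1\<close> and \<open>n - 1, \<dots>, 1, 1, \<dots>, n - 1\<close>.
  Such a product is evaluated from the centre outwards: enclosing \<open>X\<close> between two equal generators
  means multiplying it by the same generator on both sides (\<open>foldr_lact_palindrome\<close>). If \<open>X\<close> is a
  transposition \<open>(a b)\<close> and the new generator is $s_b$ or $s_{a-1}$, this moves one end of the
  transposition outwards by one step (\<open>sandwich_transpose_right\<close>, \<open>sandwich_transpose_left\<close>). The
  identity serves as the starting transposition \<open>(a a)\<close>: there only one of the two generators acts,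
  because each $\widetilde T_{s_i}$ is idempotent at \<open>\<theta> = 0\<close>. Growing the right end
  from \<open>1\<close> or the left end from \<open>n\<close> leads in either case to \<open>(1 n)\<close>.
\<close>

section \<open>Growth of the coefficients\<close>

lemma tendsto_power_ratio:
  assumes "j \<le> m"
  shows "((\<lambda>q::real. q ^ j / q ^ m) \<longlongrightarrow> of_bool (j = m)) at_top"
proof (cases "j = m")
  case True
  have "\<forall>\<^sub>F q::real in at_top. 1 = q ^ j / q ^ m"
    using eventually_gt_at_top[of 0] by eventually_elim (simp add: True)
  from Lim_transform_eventually[OF tendsto_const this] show ?thesis
    by (simp only: True of_bool_eq simp_thms)
next
  case False
  have "((\<lambda>q::real. inverse (q ^ (m - j))) \<longlongrightarrow> 0) at_top"
    using assms False
    by (intro tendsto_inverse_0_at_top filterlim_pow_at_top filterlim_ident) simp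
  moreover have "\<forall>\<^sub>F q::real in at_top. inverse (q ^ (m - j)) = q ^ j / q ^ m"
    using eventually_gt_at_top[of 0]
    by eventually_elim (use assms in \<open>simp add: power_diff field_simps\<close>)
  ultimately show ?thesis
    using False Lim_transform_eventually by fastforce
qed

lemma tendsto_qnum_over_power:
  assumes "r \<le> m"
  shows "((\<lambda>q. qnum q (Suc r) / q ^ m) \<longlongrightarrow> of_bool (r = m)) at_top"
proof -
  have *: "\<forall>\<^sub>F q in at_top. (\<Sum>i\<le>r. q ^ i / q ^ m) = qnum q (Suc r) / q ^ m"
    using eventually_gt_at_top[of 1]
  proof eventually_elim
    case (elim q)
    then have "qnum q (Suc r) = (\<Sum>i\<le>r. q ^ i)"
      by (simp only: qnum_def geometric_sum flip: lessThan_Suc_atMost)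
    then show ?case by (simp add: sum_divide_distrib)
  qed
  have "((\<lambda>q::real. \<Sum>i\<le>r. q ^ i / q ^ m) \<longlongrightarrow> (\<Sum>i\<le>r. of_bool (i = m))) at_top"
    using assms by (intro tendsto_sum tendsto_power_ratio) simp
  also have "(\<Sum>i\<le>r. of_bool (i = m)) = (of_bool (r = m) :: real)"
    using assms by (auto simp: of_bool_def)
  finally show ?thesis
    by (rule Lim_transform_eventually) (rule *)
qed

text \<open>Cancelling $q^m$ reduces the limit of a quotient to those of numerator and denominator.\<close>

lemma tendsto_quotient_over_power:
  fixes f g :: "real \<Rightarrow> real"
  assumes "((\<lambda>q. f q / q ^ m) \<longlongrightarrow> a) at_top" "((\<lambda>q. g q / q ^ m) \<longlongrightarrow> 1) at_top"
  shows "((\<lambda>q. f q / g q) \<longlongrightarrow> a) at_top"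
proof -
  have "((\<lambda>q. (f q / q ^ m) / (g q / q ^ m)) \<longlongrightarrow> a / 1) at_top"
    by (intro tendsto_divide assms) simp
  moreover have "\<forall>\<^sub>F q in at_top. (f q / q ^ m) / (g q / q ^ m) = f q / g q"
    using eventually_gt_at_top[of 0] by eventually_elim simp
  ultimately show ?thesis
    using Lim_transform_eventually by fastforce
qed

lemma tendsto_power_over_qnum:
  assumes "j \<le> m"
  shows "((\<lambda>q. q ^ j / qnum q (Suc m)) \<longlongrightarrow> of_bool (j = m)) at_top"
  using tendsto_quotient_over_power[OF tendsto_power_ratio[OF assms]]
    tendsto_qnum_over_power[of m m] by simp

section \<open>Leading terms of the shuffles\<close>

lemma coeff_limit_eqI:
  assumes "\<And>w. ((\<lambda>q. F q w) \<longlongrightarrow> f w) at_top"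
  shows "coeff_limit F = f"
  unfolding coeff_limit_def by (intro ext tendsto_Lim assms) simp

text \<open>Both factors of the random-to-random shuffle are of this kind: only \<open>i = 1\<close> carries the power
  $q^{n-1}$.\<close>

lemma coeff_limit_geometric_weights:
  assumes "n \<ge> 1"
  shows "coeff_limit (\<lambda>q w. 1 / qnum q n * (\<Sum>i=1..n. q ^ (n - i) * T (x i) w)) = T (x 1)"
proof (rule coeff_limit_eqI)
  fix w
  obtain m where n: "n = Suc m" using assms by (cases n) auto
  have "((\<lambda>q. \<Sum>i=1..n. q ^ (n - i) / qnum q n * T (x i) w)
      \<longlongrightarrow> (\<Sum>i=1..n. of_bool (n - i = m) * T (x i) w)) at_top"
    unfolding n by (intro tendsto_sum tendsto_mult tendsto_const tendsto_power_over_qnum) auto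
  also have "(\<Sum>i=1..n. of_bool (n - i = m) * T (x i) w) =
      (\<Sum>i=1..n. if i = 1 then T (x i) w else 0)"
    by (rule sum.cong) (auto simp: n)
  also have "\<dots> = T (x 1) w" using assms by simp
  finally show "((\<lambda>q. 1 / qnum q n * (\<Sum>i=1..n. q ^ (n - i) * T (x i) w)) \<longlongrightarrow> T (x 1) w) at_top"
    by (simp add: sum_distrib_left)
qed

text \<open>The normalizing sum is dominated by its first summand $[n-1]_q$, for every \<open>k\<close>.\<close>

lemma tendsto_star_normalization:
  assumes "k \<in> {1..Suc m}"
  shows "((\<lambda>q. (\<Sum>l=1..k. qnum q (m + 2 - l)) / q ^ m) \<longlongrightarrow> 1) at_top"
proof -
  have "((\<lambda>q. \<Sum>l=1..k. qnum q (Suc (m + 1 - l)) / q ^ m)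
      \<longlongrightarrow> (\<Sum>l=1..k. of_bool (m + 1 - l = m))) at_top"
    by (intro tendsto_sum tendsto_qnum_over_power) auto
  also have "(\<Sum>l=1..k. of_bool (m + 1 - l = m)) = (\<Sum>l=1..k. if l = 1 then 1 else 0 :: real)"
    by (rule sum.cong) (use assms in auto)
  also have "\<dots> = 1" using assms by simp
  also have "(\<lambda>q. \<Sum>l=1..k. qnum q (Suc (m + 1 - l)) / q ^ m) =
      (\<lambda>q. (\<Sum>l=1..k. qnum q (m + 2 - l)) / q ^ m)"
    unfolding sum_divide_distrib
    by (intro ext sum.cong refl) (use assms in \<open>auto simp: Suc_diff_le\<close>)
  finally show ?thesis .
qed

lemma coeff_limit_star_shuffle:
  assumes "n \<ge> 2" "k \<in> {1..n - 1}"
  shows "map coeff_limit (star_shuffle n k) = [T (transpose 1 n)]"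
proof -
  obtain m where n: "n = m + 2" using assms(1) by (metis le_add_diff_inverse2)
  define S where "S q = (\<Sum>l=1..k. qnum q (n - l))" for q
  have S: "((\<lambda>q. S q / q ^ m) \<longlongrightarrow> 1) at_top"
    using tendsto_star_normalization[of k m] assms(2) by (simp add: S_def n)
  have A: "((\<lambda>q. q * qnum q (n - 1) / qnum q n) \<longlongrightarrow> 1) at_top"
  proof (rule tendsto_quotient_over_power)
    show "((\<lambda>q. qnum q n / q ^ Suc m) \<longlongrightarrow> 1) at_top"
      using tendsto_qnum_over_power[of "Suc m" "Suc m"] by (simp add: n)
    have "((\<lambda>q. qnum q (n - 1) / q ^ m) \<longlongrightarrow> 1) at_top"
      using tendsto_qnum_over_power[of m m] by (simp add: n)
    then show "((\<lambda>q. q * qnum q (n - 1) / q ^ Suc m) \<longlongrightarrow> 1) at_top"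
      by (rule Lim_transform_eventually)
        (use eventually_gt_at_top[of 0] in eventually_elim, simp)
  qed
  have I: "((\<lambda>q. 1 / qnum q n) \<longlongrightarrow> 0) at_top"
    using tendsto_power_over_qnum[of 0 "Suc m"] by (simp add: n)
  have X: "((\<lambda>q. (\<Sum>l=1..k. \<Sum>i=1..n-l. q ^ (n - l - i) * T (transpose i (n + 1 - l)) w) / S q)
      \<longlongrightarrow> T (transpose 1 n) w) at_top" for w
  proof -
    have "((\<lambda>q. \<Sum>l=1..k. \<Sum>i=1..n-l. q ^ (n - l - i) / S q * T (transpose i (n + 1 - l)) w)
      \<longlongrightarrow> (\<Sum>l=1..k. \<Sum>i=1..n-l. of_bool (n - l - i = m) * T (transpose i (n + 1 - l)) w)) at_top"
      by (intro tendsto_sum tendsto_mult tendsto_const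
            tendsto_quotient_over_power[OF tendsto_power_ratio S]) (auto simp: n)
    also have "(\<Sum>l=1..k. \<Sum>i=1..n-l. of_bool (n - l - i = m) * T (transpose i (n + 1 - l)) w) =
        (\<Sum>l=1..k. if l = 1 then \<Sum>i=1..n-l. if i = 1 then T (transpose i n) w else 0 else 0)"
    proof (rule sum.cong[OF refl])
      fix l assume "l \<in> {1..k}"
      then have "n - l - i = m \<longleftrightarrow> l = 1 \<and> i = 1" if "i \<in> {1..n - l}" for i
        using that by (auto simp: n)
      then show "(\<Sum>i=1..n-l. of_bool (n - l - i = m) * T (transpose i (n + 1 - l)) w) =
          (if l = 1 then \<Sum>i=1..n-l. if i = 1 then T (transpose i n) w else 0 else 0)"
        by (cases "l = 1") (auto intro!: sum.cong sum.neutral)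
    qed
    also have "\<dots> = T (transpose 1 n) w"
      using assms by simp
    finally show ?thesis
      by (simp add: sum_divide_distrib)
  qed
  have "coeff_limit (hd (star_shuffle n k)) = T (transpose 1 n)"
  proof (rule coeff_limit_eqI)
    fix w
    have "((\<lambda>q. 1 / qnum q n * T id w + q * qnum q (n - 1) / qnum q n *
        ((\<Sum>l=1..k. \<Sum>i=1..n-l. q ^ (n - l - i) * T (transpose i (n + 1 - l)) w) / S q))
        \<longlongrightarrow> 0 * T id w + 1 * T (transpose 1 n) w) at_top"
      by (intro tendsto_add tendsto_mult tendsto_const I A X)
    then show "((\<lambda>q. hd (star_shuffle n k) q w) \<longlongrightarrow> T (transpose 1 n) w) at_top"
      by (simp add: star_shuffle_def S_def)
  qed
  then show ?thesis by (simp add: star_shuffle_def)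
qed

section \<open>Words with distinct letters\<close>

lemma sprod_le_iff: "i \<notin> set is \<Longrightarrow> sprod is x \<le> i \<longleftrightarrow> x \<le> i"
proof (induction "is")
  case (Cons j "is")
  have "sref j y \<le> i \<longleftrightarrow> y \<le> i" for y
    using Cons.prems by (auto simp: sref_def transpose_def)
  then show ?case using Cons by (simp add: sprod_Cons)
qed (simp add: sprod_Nil)

text \<open>If \<open>i\<close> does not occur in a word, then the product of the word preserves \<open>{..i}\<close>, so the
  value \<open>i\<close> is taken before the value \<open>i + 1\<close> and a further factor $s_i$ on the left adds an
  inversion.\<close>

lemma reduced_word_distinct:
  assumes "distinct is" "set is \<subseteq> {1..<n}"
  shows "reduced_word n (sprod is) is"
  using assms
proof (induction "is")
  case Nil
  show ?case unfolding reduced_word_def sprod_Nil len_id by simp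
next
  case (Cons i "is")
  define w where "w = sprod is"
  have i: "i \<in> {1..<n}" and w: "w permutes {1..n}"
    using Cons.prems(2) sprod_permutes[of "is" n] by (auto simp: w_def)
  have "w x \<le> i \<longleftrightarrow> x \<le> i" for x
    using sprod_le_iff[of i "is" x] Cons.prems(1) by (simp add: w_def)
  from this[of "inv w i"] this[of "inv w (i + 1)"]
  have "inv w i < inv w (i + 1)"
    unfolding permutes_inverses(1)[OF w] by linarith
  from len_sref_up[OF i w this] Cons show ?case
    unfolding reduced_word_def sprod_Cons w_def by auto
qed

lemma dem_sprod_sprod:
  assumes "distinct is" "set is \<subseteq> {1..<n}" "distinct js" "set js \<subseteq> {1..<n}"
  shows "dem n (sprod is) (sprod js) = foldr (lact n) (is @ js) id"
proof -
  have "sprod js = foldr (lact n) js id"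
    using reduced_word_distinct[OF assms(3,4)] reduced_foldr[of js n]
    by (auto simp: reduced_word_def)
  then show ?thesis
    using dem_eq[OF reduced_word_distinct[OF assms(1,2)] sprod_permutes[OF assms(4)]] by simp
qed

section \<open>Products along palindromes\<close>

text \<open>The last letter of the palindrome acts first on the identity, where it is the same as a right
  action; right actions commute past all the left ones.\<close>

lemma foldr_lact_palindrome:
  assumes "set is \<subseteq> {1..<n}"
  shows "foldr (lact n) (is @ rev is) id = foldr (\<lambda>i w. lact n i (ract i w)) is id"
  using assms
proof (induction "is")
  case (Cons i "is")
  then have i: "i \<in> {1..<n}" and "is": "set is \<subseteq> {1..<n}" by auto
  have "lact n i id = ract i id"
    using lact_altdef[OF i permutes_id] by (simp add: ract_def)
  then have "foldr (lact n) (is @ rev is) (lact n i id) = ract i (foldr (lact n) (is @ rev is) id)"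
    using foldr_lact_ract[of "is @ rev is" n "[i]" id] i "is" by (simp add: permutes_id)
  then show ?case using Cons.IH[OF "is"] by (simp add: id_def)
qed simp

text \<open>Conjugation by $s_b$ turns \<open>(a b)\<close> into \<open>(a b+1)\<close>, and for \<open>a < b\<close> the two multiplications by
  $s_b$ both add inversions. For \<open>a = b\<close> the right action already gives $s_b$, and the left action
  changes nothing.\<close>

lemma sandwich_transpose_right:
  assumes "1 \<le> a" "a \<le> b" "b < n"
  shows "lact n b (ract b (transpose a b)) = transpose a (b + 1)"
proof -
  have b: "b \<in> {1..<n}" using assms by simp
  have p: "transpose a b permutes {1..n}" using assms by (intro permutes_swap_id) auto
  have r: "ract b (transpose a b) = transpose a b \<circ> sref b"
    using assms by (auto simp: ract_def transpose_def)
  have i: "inv (transpose a b \<circ> sref b) = sref b \<circ> transpose a b"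
    using permutes_bij[OF p] permutes_bij[OF sref_permutes[OF b]]
    by (simp add: o_inv_distrib inv_sref)
  show ?thesis
    unfolding r lact_altdef[OF b permutes_compose[OF sref_permutes[OF b] p]] i
    using assms by (auto simp: sref_def transpose_def fun_eq_iff)
qed

lemma sandwich_transpose_left:
  assumes "1 \<le> a" "a < b" "b \<le> n"
  shows "lact n a (ract a (transpose (a + 1) b)) = transpose a b"
proof -
  have a: "a \<in> {1..<n}" using assms by simp
  have p: "transpose (a + 1) b permutes {1..n}" using assms by (intro permutes_swap_id) auto
  have r: "ract a (transpose (a + 1) b) = transpose (a + 1) b \<circ> sref a"
    using assms by (auto simp: ract_def transpose_def)
  have i: "inv (transpose (a + 1) b \<circ> sref a) = sref a \<circ> transpose (a + 1) b"
    using permutes_bij[OF p] permutes_bij[OF sref_permutes[OF a]]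
    by (simp add: o_inv_distrib inv_sref)
  show ?thesis
    unfolding r lact_altdef[OF a permutes_compose[OF sref_permutes[OF a] p]] i
    using assms by (auto simp: sref_def transpose_def fun_eq_iff)
qed

lemma lact_down_up:
  assumes "1 \<le> a" "a \<le> b" "b \<le> n"
  shows "foldr (lact n) (rev [a..<b] @ [a..<b]) id = transpose a b"
proof -
  have "foldr (\<lambda>i w. lact n i (ract i w)) (rev [a..<b]) id = transpose a b"
    using assms(2,3)
  proof (induction b rule: dec_induct)
    case (step b)
    then show ?case using sandwich_transpose_right[of a b n] assms(1) by simp
  qed simp
  then show ?thesis
    using foldr_lact_palindrome[of "rev [a..<b]" n] assms by fastforce
qed

lemma lact_up_down:
  assumes "1 \<le> a" "a \<le> b" "b \<le> n"
  shows "foldr (lact n) ([a..<b] @ rev [a..<b]) id = transpose a b"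
proof -
  have "foldr (\<lambda>i w. lact n i (ract i w)) [a..<b] id = transpose a b"
    using assms(2,1)
  proof (induction a rule: inc_induct)
    case (step a)
    then show ?case using sandwich_transpose_left[of a b n] assms(3)
      by (simp add: upt_conv_Cons)
  qed simp
  then show ?thesis
    using foldr_lact_palindrome[of "[a..<b]" n] assms by fastforce
qed

section \<open>The values at \<open>\<theta> = 0\<close>\<close>

lemma at_theta0_generators:
  assumes "set is \<subseteq> {1..<n}"
  shows "at_theta0 n (map (\<lambda>i q. T (sref i)) is) = T (foldr (lact n) is id)"
  using assms
proof (induction "is")
  case (Cons i "is")
  then have i: "i \<in> {1..<n}" and "is": "set is \<subseteq> {1..<n}" by auto
  have w: "foldr (lact n) is id permutes {1..n}"
    using foldr_lact_permutes[OF "is" permutes_id] .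
  have "coeff_limit (\<lambda>q. T (sref i)) = T (sref i)"
    by (rule coeff_limit_eqI) (rule tendsto_const)
  then show ?case
    using Cons.IH[OF "is"] hmult_T_T[OF sref_permutes[OF i] w] dem_sref[OF i w]
    by (simp add: at_theta0_def id_def)
qed (simp add: at_theta0_def)

theorem theorem5p1:
  fixes n :: nat
  assumes "n \<ge> 2"
  shows "\<forall>k\<in>{1..n - 1}.
      at_theta0 n (star_shuffle n k) = at_theta0 n (random_to_random n) \<and>
      at_theta0 n (random_to_random n) = at_theta0 n (systematic_scan n) \<and>
      at_theta0 n (systematic_scan n) = T (transpose 1 n)"
proof -
  have n: "1 \<le> n" using assms by simp
  have star: "at_theta0 n (star_shuffle n k) = T (transpose 1 n)" if "k \<in> {1..n - 1}" for k
  proof -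
    have "transpose 1 n permutes {1..n}" using n by (intro permutes_swap_id) auto
    then show ?thesis
      using coeff_limit_star_shuffle[OF assms that] hmult_id_right[OF T_in_carrier]
      by (simp add: at_theta0_def)
  qed
  have scan: "at_theta0 n (systematic_scan n) = T (transpose 1 n)"
    unfolding systematic_scan_def using n
    by (subst at_theta0_generators) (auto simp only: lact_down_up order_refl, auto)
  have "at_theta0 n (random_to_random n) = T (transpose 1 n)"
  proof -
    define c d where "c = sprod [1..<n]" and "d = sprod (rev [1..<n])"
    have cd: "c permutes {1..n}" "d permutes {1..n}"
      unfolding c_def d_def by (rule sprod_permutes; simp)+
    have "map coeff_limit (random_to_random n) = [T c, T d]"
      unfolding random_to_random_def c_def d_def
      by (simp only: list.map coeff_limit_geometric_weights[OF n])
    then have "at_theta0 n (random_to_random n) = T (dem n c d)"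
      using hmult_T_T[OF cd] hmult_id_right[OF T_in_carrier[OF cd(2)]] by (simp add: at_theta0_def)
    also have "dem n c d = foldr (lact n) ([1..<n] @ rev [1..<n]) id"
      unfolding c_def d_def by (rule dem_sprod_sprod) auto
    also have "\<dots> = transpose 1 n"
      using n by (intro lact_up_down) auto
    finally show ?thesis .
  qed
  with star scan show ?thesis by simp
qed

end
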